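(* Let $\theta\colon\mathbb{Z}\to\mathbb{Z}$, $z\mapsto 0$, be the annihilating homomorphism of the additive group of integers, and let $\tau$ be a Hausdorff locally compact shift-continuous topology on $\mathbf{B}(\mathbb{Z},\theta)^0$ such that the topology induced by $\tau$ on $\mathbf{B}(\mathbb{Z},\theta)$ is discrete. Then $\tau$ is discrete.
   Context: $\mathbb{N}_0$ is the set of non-negative integers. A topology on a semigroup is shift-continuous if multiplication is separately continuous. The Reilly semigroup $\mathbf{B}(\mathbb{Z},\theta)$ is the set $\mathbb{N}_0\times\mathbb{Z}\times\mathbb{N}_0$ with $$(i,s,j)\cdot(m,t,n)=\left(i+m-\min\{j,m\},\ \theta^{m-\min\{j,m\}}(s)+\theta^{j-\min\{j,m\}}(t),\ j+n-\min\{j,m\}\right),$$ where $\theta^0$ is the identity map and $\theta^k$ is the $k$-fold iterate. $\mathbf{B}(\mathbb{Z},\theta)^0=\mathbf{B}(\mathbb{Z},\theta)\sqcup\{\mathbf{0}\}$ is $\mathbf{B}(\mathbb{Z},\theta)$ with an adjoined zero $\mathbf{0}$. *)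

theory Defs
  imports "HOL-Analysis.Analysis"
begin

definition reilly_mult ::
    "(int \<Rightarrow> int) \<Rightarrow> nat \<times> int \<times> nat \<Rightarrow> nat \<times> int \<times> nat \<Rightarrow> nat \<times> int \<times> nat"
  where
  "reilly_mult \<theta> = (\<lambda>(i, s, j) (m, t, n).
     (i + m - min j m,
      (\<theta> ^^ (m - min j m)) s + (\<theta> ^^ (j - min j m)) t,
      j + n - min j m))"

text \<open>The semigroup with an adjoined zero lives on the option type: \<^term>\<open>None\<close> is the zero
  and \<^term>\<open>range Some\<close> is the copy of the original semigroup.\<close>

definition adjoin_zero_mult :: "('a \<Rightarrow> 'a \<Rightarrow> 'a) \<Rightarrow> 'a option \<Rightarrow> 'a option \<Rightarrow> 'a option"
  where
  "adjoin_zero_mult f x y =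
     (case (x, y) of (Some a, Some b) \<Rightarrow> Some (f a b) | _ \<Rightarrow> None)"

definition shift_continuous :: "'a topology \<Rightarrow> ('a \<Rightarrow> 'a \<Rightarrow> 'a) \<Rightarrow> bool"
  where
  "shift_continuous T f \<longleftrightarrow>
     (\<forall>a \<in> topspace T. continuous_map T T (\<lambda>x. f a x) \<and> continuous_map T T (\<lambda>x. f x a))"

lemma funpow_additive:
  fixes \<theta> :: "int \<Rightarrow> int"
  assumes "\<And>x y. \<theta> (x + y) = \<theta> x + \<theta> y"
  shows "(\<theta> ^^ k) (x + y) = (\<theta> ^^ k) x + (\<theta> ^^ k) y"
  by (induction k) (simp_all add: assms)

lemma reilly_mult_assoc:
  assumes "\<And>x y. \<theta> (x + y) = \<theta> x + \<theta> y"
  shows "reilly_mult \<theta> (reilly_mult \<theta> a b) c = reilly_mult \<theta> a (reilly_mult \<theta> b c)"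
proof -
  obtain i s j m t n p u q where abc: "a = (i, s, j)" "b = (m, t, n)" "c = (p, u, q)"
    by (metis prod_cases3)
  have pow: "(\<theta> ^^ k) ((\<theta> ^^ l) x) = (\<theta> ^^ (k + l)) x" for k l x
    by (simp add: funpow_add)
  show ?thesis
    unfolding abc reilly_mult_def
    by (cases "j \<le> m"; cases "n \<le> p"; cases "j + n \<le> m + p")
       (auto simp: funpow_additive[OF assms] pow min_def add.assoc
             intro!: arg_cong2[where f = "(+)"] arg_cong[where f = "\<lambda>k. (\<theta> ^^ k) _"])
qed

lemma adjoin_zero_mult_assoc:
  assumes "\<And>x y z. f (f x y) z = f x (f y z)"
  shows "adjoin_zero_mult f (adjoin_zero_mult f a b) c
    = adjoin_zero_mult f a (adjoin_zero_mult f b c)"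
  by (simp add: adjoin_zero_mult_def assms split: option.split)

end

theory Submission
  imports Defs
begin

text \<open>
  Every nonzero point is isolated, so a compact neighbourhood \<open>K\<close> of the zero is determined by the
  set \<open>A\<close> of nonzero elements in \<open>K\<close>, and every other neighbourhood of the zero contains all but
  finitely many elements of \<open>A\<close>. Thus \<open>K\<close> is the one-point compactification of the discrete
  set \<open>A\<close>. The zero is isolated exactly when \<open>A\<close> is finite, so the task is to exclude that
  translations of the semigroup are continuous at the point at infinity of an infinite \<open>A\<close>.

  Continuity of a translation \<open>g\<close> at infinity says that \<open>g\<close> sends all but finitely many elements
  of \<open>A\<close> into \<open>A\<close> and has finite fibres on \<open>A\<close> (\<open>fixes_infinity\<close>). Since \<open>\<theta>\<close> annihilates,
  left multiplication by \<open>(0, 0, 1)\<close> is the shift \<open>(m + 1, t, n) \<mapsto> (m, t, n)\<close> but collapses all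
  \<open>(0, t, n)\<close> with the same \<open>n\<close> to one element, so each set \<open>{t. (0, t, n) \<in> A}\<close> is finite. Such a
  set, if nonempty, is not invariant under \<open>t \<mapsto> t + 1\<close>, which is how \<open>(0, 1, 0)\<close> acts on the
  elements with first index \<open>0\<close>. Only finitely many elements may leave \<open>A\<close>, so \<open>A\<close> contains only
  finitely many elements with first index \<open>0\<close>, and by shifting down only finitely many with any
  given first index. Reversing triples is an anti-automorphism, so the same holds for the last index.

  If \<open>A\<close> were infinite, its elements would therefore have infinitely many last indices \<open>n\<close>. For all
  but finitely many \<open>n\<close> the shift \<open>(m + 1, t, n) \<mapsto> (m, t, n)\<close> never leaves \<open>A\<close>, and iterating it
  ends at an element \<open>(0, t, n)\<close> of \<open>A\<close>. There are only finitely many of those, a contradiction.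
\<close>

section \<open>Compact neighbourhoods of the only possibly non-isolated point\<close>

text \<open>A compact set minus a neighbourhood of \<open>p\<close> is covered by isolated points.\<close>

lemma finite_compact_diff_neighbourhood:
  assumes iso: "\<And>x. x \<in> topspace X \<Longrightarrow> x \<noteq> p \<Longrightarrow> openin X {x}"
    and K: "compactin X K" and V: "openin X V" "p \<in> V"
  shows "finite (K - V)"
proof -
  let ?C = "insert V ((\<lambda>x. {x}) ` (K - V))"
  have KX: "K \<subseteq> topspace X"
    using K compactin_subset_topspace by blast
  have "\<And>B. B \<in> ?C \<Longrightarrow> openin X B"
    using V iso KX by blast
  moreover have "K \<subseteq> \<Union>?C"
    by blast
  ultimately obtain D where D: "finite D" "D \<subseteq> ?C" "K \<subseteq> \<Union>D"
    using compactinD[OF K] by metis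
  have "(\<lambda>x. {x}) ` (K - V) \<subseteq> D"
  proof clarify
    fix x assume x: "x \<in> K" "x \<notin> V"
    then obtain B where "B \<in> D" "x \<in> B"
      using D(3) by blast
    moreover from this have "B = {x}"
      using D(2) x(2) by blast
    ultimately show "{x} \<in> D"
      by simp
  qed
  then have "finite ((\<lambda>x. {x}) ` (K - V))"
    using D(1) finite_subset by blast
  then show ?thesis
    by (rule finite_imageD) (simp add: inj_on_def)
qed

lemma compact_open_neighbourhood:
  assumes iso: "\<And>x. x \<in> topspace X \<Longrightarrow> x \<noteq> p \<Longrightarrow> openin X {x}"
    and lc: "locally_compact_space X" and p: "p \<in> topspace X"
  obtains K where "compactin X K" "openin X K" "p \<in> K"
proof -
  obtain U K where UK: "openin X U" "compactin X K" "p \<in> U" "U \<subseteq> K"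
    using lc p unfolding locally_compact_space_def by blast
  have KX: "K \<subseteq> topspace X"
    using UK(2) compactin_subset_topspace by blast
  have "openin X (U \<union> \<Union>((\<lambda>x. {x}) ` (K - U)))"
    using UK(1,3) iso KX by (intro openin_Un openin_Union) auto
  moreover have "U \<union> \<Union>((\<lambda>x. {x}) ` (K - U)) = K"
    using UK(4) by blast
  ultimately show thesis
    using that[of K] UK by auto
qed

section \<open>Translations fixing the point at infinity\<close>

text \<open>This is continuity at infinity of the extension of \<open>g\<close> to the one-point compactification
  of the discrete set \<open>A\<close>: the cofinite subsets \<open>A - F\<close> are the punctured neighbourhoods of
  infinity. Allowing \<open>F\<close> to vary encodes that \<open>g\<close> is finite-to-one.\<close>

definition fixes_infinity :: "('a \<Rightarrow> 'a) \<Rightarrow> 'a set \<Rightarrow> bool"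
  where "fixes_infinity g A \<longleftrightarrow> (\<forall>F. finite F \<longrightarrow> finite {x \<in> A. g x \<notin> A - F})"

lemma fixes_infinityD:
  assumes "fixes_infinity g A" "finite F"
  shows "finite {x \<in> A. g x \<notin> A - F}"
  using assms by (simp add: fixes_infinity_def)

lemma continuous_map_fixes_infinity:
  fixes X :: "'a option topology"
  assumes top: "topspace X = UNIV" and t1: "t1_space X"
    and iso: "\<And>x. openin X {Some x}"
    and K: "compactin X K" "openin X K" "None \<in> K"
    and h: "continuous_map X X h" "h None = None" "\<And>x. h (Some x) = Some (g x)"
  shows "fixes_infinity g {x. Some x \<in> K}"
  unfolding fixes_infinity_def
proof (intro allI impI)
  fix F :: "'a set" assume F: "finite F"
  let ?V = "{x \<in> topspace X. h x \<in> K - Some ` F}"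
  have "closedin X (Some ` F)"
    using t1 F top by (metis t1_space_closedin_finite finite_imageI top_greatest)
  then have "openin X (K - Some ` F)"
    using K(2) by blast
  then have "openin X ?V"
    using h(1) by (rule openin_continuous_map_preimage[rotated])
  moreover have "None \<in> ?V"
    using h(2) K(3) top by auto
  ultimately have "finite (K - ?V)"
    using iso K(1) by (intro finite_compact_diff_neighbourhood[where p = None and X = X])
      (auto simp: not_None_eq)
  moreover have "Some ` {x \<in> {x. Some x \<in> K}. g x \<notin> {x. Some x \<in> K} - F} \<subseteq> K - ?V"
    using h(3) by auto
  ultimately show "finite {x \<in> {x. Some x \<in> K}. g x \<notin> {x. Some x \<in> K} - F}"
    by (meson finite_imageD finite_subset inj_Some subset_UNIV inj_on_subset)
qed

section \<open>Combinatorics of the Reilly semigroup with annihilating homomorphism\<close>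

lemma funpow_annihilating:
  fixes \<theta> :: "int \<Rightarrow> int"
  assumes "\<And>z. \<theta> z = 0"
  shows "(\<theta> ^^ k) s = (if k = 0 then s else 0)"
  by (cases k) (simp_all add: assms)

fun reverse_triple :: "nat \<times> int \<times> nat \<Rightarrow> nat \<times> int \<times> nat"
  where "reverse_triple (i, s, j) = (j, s, i)"

lemma reverse_triple_invol [simp]: "reverse_triple (reverse_triple x) = x"
  by (cases x) simp

lemma reverse_triple_reilly_mult:
  "reverse_triple (reilly_mult \<theta> x y) = reilly_mult \<theta> (reverse_triple y) (reverse_triple x)"
  by (cases x; cases y) (simp add: reilly_mult_def min.commute add.commute)

text \<open>On first index \<open>0\<close> the element \<open>(0, 0, 1)\<close> forgets the middle entry, while \<open>(0, 1, 0)\<close>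
  increases it by one. Finite fibres of the first translation leave finitely many middle entries for
  each last index; the second then pushes an element out of \<open>A\<close> for every last index that occurs,
  so finitely many last indices occur.\<close>

lemma finite_zero_row:
  assumes ann: "\<And>z. \<theta> z = 0"
    and left: "\<And>a. fixes_infinity (reilly_mult \<theta> a) A"
  shows "finite {x \<in> A. fst x = 0}"
proof -
  define Z where "Z n = {t. (0, t, n) \<in> A}" for n
  have finZ: "finite (Z n)" for n
  proof -
    have "(\<lambda>t. (0, t, n)) ` Z n
        \<subseteq> {x \<in> A. reilly_mult \<theta> (0, 0, 1) x \<notin> A - {(0, 0, n + 1)}}"
      by (auto simp: Z_def reilly_mult_def funpow_annihilating[OF ann])
    moreover have "finite {x \<in> A. reilly_mult \<theta> (0, 0, 1) x \<notin> A - {(0, 0, n + 1)}}"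
      using left by (rule fixes_infinityD) simp
    ultimately have "finite ((\<lambda>t. (0 :: nat, t, n)) ` Z n)"
      by (rule finite_subset)
    then show ?thesis
      by (rule finite_imageD) (simp add: inj_on_def)
  qed
  define E where "E = {x \<in> A. reilly_mult \<theta> (0, 1, 0) x \<notin> A - {}}"
  have finE: "finite E"
    unfolding E_def using left by (rule fixes_infinityD) simp
  have col: "n \<in> (snd \<circ> snd) ` E" if "(0, t, n) \<in> A" for t n
  proof -
    \<comment> \<open>The nonempty finite set \<open>Z n\<close> loses its maximum under \<open>t \<mapsto> t + 1\<close>.\<close>
    let ?M = "Max (Z n)"
    have "t \<in> Z n"
      using that by (simp add: Z_def)
    then have M: "?M \<in> Z n"
      using finZ by (metis Max_in empty_iff)
    have "?M + 1 \<notin> Z n"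
      using Max_ge[OF finZ, of "?M + 1" n] by auto
    with M have "(0, ?M, n) \<in> E"
      by (auto simp: E_def Z_def reilly_mult_def add.commute)
    then show ?thesis
      by force
  qed
  have "{x \<in> A. fst x = 0} \<subseteq> (\<Union>n \<in> (snd \<circ> snd) ` E. (\<lambda>t. (0, t, n)) ` Z n)"
  proof
    fix x assume x: "x \<in> {x \<in> A. fst x = 0}"
    then obtain t n where tn: "x = (0, t, n)"
      by (metis (mono_tags, lifting) fst_conv mem_Collect_eq prod_cases3)
    with x have "(0, t, n) \<in> A"
      by simp
    with col[OF this] show "x \<in> (\<Union>n \<in> (snd \<circ> snd) ` E. (\<lambda>t. (0, t, n)) ` Z n)"
      unfolding tn Z_def by blast
  qed
  then show ?thesis
    by (rule finite_subset) (intro finite_UN_I finite_imageI finE finZ)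
qed

text \<open>Left multiplication by \<open>(0, 0, m)\<close> moves the elements with first index \<open>m\<close> to first
  index \<open>0\<close>, so each of them either leaves \<open>A\<close> or lands in a finite subset of \<open>A\<close>. Either happens
  only finitely often.\<close>

lemma finite_row:
  assumes ann: "\<And>z. \<theta> z = 0"
    and left: "\<And>a. fixes_infinity (reilly_mult \<theta> a) A"
  shows "finite {x \<in> A. fst x = m}"
proof -
  let ?R = "{x \<in> A. fst x = 0}"
  have "{x \<in> A. fst x = m} \<subseteq> {x \<in> A. reilly_mult \<theta> (0, 0, m) x \<notin> A - ?R}"
    by (auto simp: reilly_mult_def)
  moreover have "finite {x \<in> A. reilly_mult \<theta> (0, 0, m) x \<notin> A - ?R}"
    using left finite_zero_row[OF ann left] by (rule fixes_infinityD)
  ultimately show ?thesis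
    by (rule finite_subset)
qed

lemma finite_column:
  assumes ann: "\<And>z. \<theta> z = 0"
    and right: "\<And>a. fixes_infinity (\<lambda>x. reilly_mult \<theta> x a) A"
  shows "finite {x \<in> A. snd (snd x) = n}"
proof -
  have inj: "inj reverse_triple"
    by (metis injI reverse_triple_invol)
  have mem: "x \<in> reverse_triple ` B \<longleftrightarrow> reverse_triple x \<in> B" for x B
    by (metis image_iff reverse_triple_invol)
  have "fixes_infinity (reilly_mult \<theta> a) (reverse_triple ` A)" for a
    unfolding fixes_infinity_def
  proof (intro allI impI)
    fix F :: "(nat \<times> int \<times> nat) set" assume F: "finite F"
    have "finite {x \<in> A. reilly_mult \<theta> x (reverse_triple a) \<notin> A - reverse_triple ` F}"
      using right F by (intro fixes_infinityD) simp_all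
    moreover have "{x \<in> reverse_triple ` A. reilly_mult \<theta> a x \<notin> reverse_triple ` A - F}
        = reverse_triple ` {x \<in> A. reilly_mult \<theta> x (reverse_triple a) \<notin> A - reverse_triple ` F}"
      by (auto simp: mem reverse_triple_reilly_mult)
    ultimately show
      "finite {x \<in> reverse_triple ` A. reilly_mult \<theta> a x \<notin> reverse_triple ` A - F}"
      by simp
  qed
  from finite_row[OF ann this]
  have "finite {x \<in> reverse_triple ` A. fst x = n}" .
  moreover have "reverse_triple ` {x \<in> A. snd (snd x) = n} \<subseteq> {x \<in> reverse_triple ` A. fst x = n}"
    by auto
  ultimately show ?thesis
    using inj by (meson finite_imageD finite_subset inj_on_subset subset_UNIV)
qed

text \<open>The shift \<open>(m + 1, t, n) \<mapsto> (m, t, n)\<close> leads every element of \<open>A\<close> to an element that the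
  shift throws out of \<open>A\<close> or to one with first index \<open>0\<close>, without changing \<open>n\<close>. There are only
  finitely many such end points, hence finitely many values of \<open>n\<close>.\<close>

lemma finite_if_translations_fix_infinity:
  assumes ann: "\<And>z. \<theta> z = 0"
    and left: "\<And>a. fixes_infinity (reilly_mult \<theta> a) A"
    and right: "\<And>a. fixes_infinity (\<lambda>x. reilly_mult \<theta> x a) A"
  shows "finite A"
proof -
  define E where "E = {x \<in> A. reilly_mult \<theta> (0, 0, 1) x \<notin> A - {}} \<union> {x \<in> A. fst x = 0}"
  have finE: "finite E"
    unfolding E_def
    using fixes_infinityD[OF left, of "{}"] finite_zero_row[OF ann left] by blast
  have col: "n \<in> (snd \<circ> snd) ` E" if "(m, t, n) \<in> A" for m t n
    using that
  proof (induction m)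
    case 0
    then have "(0, t, n) \<in> E"
      by (simp add: E_def)
    then show ?case
      by force
  next
    case (Suc m)
    show ?case
    proof (cases "(Suc m, t, n) \<in> E")
      case True
      then show ?thesis
        by force
    next
      case False
      then have "(m, t, n) \<in> A"
        using Suc.prems by (simp add: E_def reilly_mult_def funpow_annihilating[OF ann])
      then show ?thesis
        by (rule Suc.IH)
    qed
  qed
  have "A \<subseteq> (\<Union>n \<in> (snd \<circ> snd) ` E. {x \<in> A. snd (snd x) = n})"
    using col by fastforce
  then show ?thesis
    by (rule finite_subset) (intro finite_UN_I finite_imageI finE finite_column[OF ann right])
qed

section \<open>Discreteness\<close>

theorem proposition4p11:
  fixes \<theta> :: "int \<Rightarrow> int"
    and \<tau> :: "(nat \<times> int \<times> nat) option topology"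
  assumes annihilating: "\<And>z. \<theta> z = 0"
    and carrier: "topspace \<tau> = UNIV"
    and hausdorff: "Hausdorff_space \<tau>"
    and loc_compact: "locally_compact_space \<tau>"
    and shift: "shift_continuous \<tau> (adjoin_zero_mult (reilly_mult \<theta>))"
    and induced: "subtopology \<tau> (range Some) = discrete_topology (range Some)"
  shows "\<tau> = discrete_topology UNIV"
proof -
  have t1: "t1_space \<tau>"
    using hausdorff by (rule Hausdorff_imp_t1_space)
  have closed: "closedin \<tau> B" if "finite B" for B
    using t1 that carrier by (metis t1_space_closedin_finite top_greatest)
  have "openin \<tau> (UNIV - {None})"
    using closed[of "{None}"] carrier openin_diff[OF openin_topspace] by fastforce
  moreover have "UNIV - {None} = range (Some :: nat \<times> int \<times> nat \<Rightarrow> _)"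
    by (auto simp: UNIV_option_conv)
  ultimately have open_S: "openin \<tau> (range Some)"
    by (simp only:)
  have iso: "openin \<tau> {Some x}" for x
  proof -
    have "openin (subtopology \<tau> (range Some)) {Some x}"
      unfolding induced by simp
    then show ?thesis
      using open_S by (meson openin_trans_full)
  qed
  have iso': "openin \<tau> {y}" if "y \<noteq> None" for y
    using that iso by auto
  obtain K where K: "compactin \<tau> K" "openin \<tau> K" "None \<in> K"
    using compact_open_neighbourhood[of \<tau> None] iso' loc_compact carrier by auto
  let ?A = "{x. Some x \<in> K}"
  have cont: "continuous_map \<tau> \<tau> (adjoin_zero_mult (reilly_mult \<theta>) y)"
    "continuous_map \<tau> \<tau> (\<lambda>x. adjoin_zero_mult (reilly_mult \<theta>) x y)" for y
    using shift carrier by (auto simp: shift_continuous_def)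
  have "fixes_infinity (reilly_mult \<theta> a) ?A" for a
    by (rule continuous_map_fixes_infinity[OF carrier t1 iso K cont(1)[of "Some a"]])
      (simp_all add: adjoin_zero_mult_def)
  moreover have "fixes_infinity (\<lambda>x. reilly_mult \<theta> x a) ?A" for a
    by (rule continuous_map_fixes_infinity[OF carrier t1 iso K cont(2)[of "Some a"]])
      (simp_all add: adjoin_zero_mult_def)
  ultimately have "finite ?A"
    by (rule finite_if_translations_fix_infinity[OF annihilating])
  then have "openin \<tau> (K - Some ` ?A)"
    using K(2) closed[OF finite_imageI] by (intro openin_diff)
  moreover have "K - Some ` ?A = {None}"
  proof
    show "K - Some ` ?A \<subseteq> {None}"
    proof
      fix y assume "y \<in> K - Some ` ?A"
      then show "y \<in> {None}"
        by (cases y) auto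
    qed
  qed (use K(3) in auto)
  ultimately have "openin \<tau> {None}"
    by (simp only:)
  then have "openin \<tau> {y}" for y
    using iso' by (cases "y = None") simp_all
  then show ?thesis
    using carrier discrete_topology_unique[of UNIV \<tau>] by metis
qed

end
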